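(* Let $\phi:\mathcal F\to\mathbb R$ be a penalty and let $Z_1^n=(Z_1,\dots,Z_n)$ be an i.i.d. sample from $P$, with $Z=(X,Y)\sim P$ independent of $Z_1^n$. For any predictor $\widehat g_n\in\widehat{\mathcal F}$ depending on $Z_1^n$, $$\mathbb E\big[\mathcal E_\phi(\widehat g_n)\big]\le \mathbb E_{Z_1^n,X}\Big[\sup_{y\in\mathcal Y}\Big\{\ell(\widehat g_n(X),y)-\ell_\phi\big(\widehat f_{\phi,n}^{(X,y)},(X,y)\big)\Big\}\Big].\qquad(\ast)$$ In addition, the right-hand side of $(\ast)$ is minimized (over predictors $\widehat g_n$ depending on $Z_1^n$) by the predictor $$\widetilde f_{\phi,n}(x)=\operatorname*{arg\,min}_{\widehat y\in\widehat{\mathcal Y}}\ \sup_{y\in\mathcal Y}\Big\{\ell(\widehat y,y)-\ell_\phi\big(\widehat f_{\phi,n}^{(x,y)},(x,y)\big)\Big\}$$ (called the Sample Minmax Predictor, SMP), whenever it exists, in which case $$\mathbb E\big[\mathcal E_\phi(\widetilde f_{\phi,n})\big]\le \mathbb E_{Z_1^n,X}\Big[\inf_{\widehat y\in\widehat{\mathcal Y}}\ \sup_{y\in\mathcal Y}\Big\{\ell(\widehat y,y)-\ell_\phi\big(\widehat f_{\phi,n}^{(X,y)},(X,y)\big)\Big\}\Big].$$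
   Context: $\mathcal X,\mathcal Y,\widehat{\mathcal Y}$ are measurable spaces, $\mathcal Z=\mathcal X\times\mathcal Y$, $\ell:\widehat{\mathcal Y}\times\mathcal Y\to\mathbb R$ is a loss function, $\widehat{\mathcal F}$ is the set of measurable maps $\mathcal X\to\widehat{\mathcal Y}$ (predictors), and $\mathcal F\subset\widehat{\mathcal F}$ is a class of predictors. $P$ is a probability distribution on $\mathcal Z$. For $z=(x,y)$: $\ell(g,z)=\ell(g(x),y)$ for $g\in\widehat{\mathcal F}$, and $\ell_\phi(f,z)=\ell(f(x),y)+\phi(f)$ for $f\in\mathcal F$. The risk is $\mathcal R(g)=\mathbb E_{Z\sim P}[\ell(g,Z)]$, the penalized risk is $\mathcal R_\phi(f)=\mathbb E_{Z\sim P}[\ell_\phi(f,Z)]$ for $f\in\mathcal F$, and the penalized excess risk of $g\in\widehat{\mathcal F}$ is $\mathcal E_\phi(g)=\mathcal R(g)-\inf_{f\in\mathcal F}\mathcal R_\phi(f)$. For $z\in\mathcal Z$, $\widehat f_{\phi,n}^{z}\in\operatorname{arg\,min}_{f\in\mathcal F}\{\sum_{i=1}^n\ell_\phi(f,Z_i)+\ell_\phi(f,z)\}$. Standing assumptions: risks are well defined in $\mathbb R\cup\{+\infty\}$ and $\inf_{f\in\mathcal F}\mathcal R_\phi(f)$ is finite, all expectations appearing are well defined and the functions involved are measurable; for every $z\in\mathcal Z$ the minimum over $f\in\mathcal F$ of $\sum_{i=1}^n\ell_\phi(f,Z_i)+\ell_\phi(f,z)$ is attained, and the minimizers $\widehat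 f_{\phi,n}^{z}$ are chosen as a symmetric function of the $n+1$ sample points $Z_1,\dots,Z_n,z$.
   Formalization: The loss of the predictor at the test point is assumed to have a well-defined expectation jointly over the sample and the test point, not only as an iterated expectation; with the iterated one alone the inequality can fail because Fubini's theorem does not apply. *)

theory Defs
  imports "HOL-Probability.Probability" "HOL-Combinatorics.Permutations"
begin

(* Expectations with values in [-\<infinity>, +\<infinity>]: risks may be +\<infinity>, and the suprema below
   are taken in ereal, so the real-valued Bochner integral does not apply.
   e2ennreal sends negative numbers to 0, hence the two terms are the integrals of the positive
   and the negative part. The difference is only meaningful under quasi_integrable. *)

definition quasi_integrable :: "'a measure \<Rightarrow> ('a \<Rightarrow> ereal) \<Rightarrow> bool" where
  "quasi_integrable M h \<longleftrightarrow> h \<in> borel_measurable M \<and>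
     ((\<integral>\<^sup>+ x. e2ennreal (h x) \<partial>M) < \<infinity> \<or> (\<integral>\<^sup>+ x. e2ennreal (- h x) \<partial>M) < \<infinity>)"

definition expect :: "'a measure \<Rightarrow> ('a \<Rightarrow> ereal) \<Rightarrow> ereal" where
  "expect M h = enn2ereal (\<integral>\<^sup>+ x. e2ennreal (h x) \<partial>M) - enn2ereal (\<integral>\<^sup>+ x. e2ennreal (- h x) \<partial>M)"

definition pred_loss :: "('w \<Rightarrow> 'y \<Rightarrow> real) \<Rightarrow> ('x \<Rightarrow> 'w) \<Rightarrow> 'x \<times> 'y \<Rightarrow> real" where
  "pred_loss l g z = l (g (fst z)) (snd z)"

definition pen_loss ::
  "('w \<Rightarrow> 'y \<Rightarrow> real) \<Rightarrow> (('x \<Rightarrow> 'w) \<Rightarrow> real) \<Rightarrow> ('x \<Rightarrow> 'w) \<Rightarrow> 'x \<times> 'y \<Rightarrow> real" where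
  "pen_loss l \<phi> f z = l (f (fst z)) (snd z) + \<phi> f"

definition risk :: "('x \<times> 'y) measure \<Rightarrow> ('w \<Rightarrow> 'y \<Rightarrow> real) \<Rightarrow> ('x \<Rightarrow> 'w) \<Rightarrow> ereal" where
  "risk P l g = expect P (\<lambda>z. ereal (pred_loss l g z))"

definition pen_risk ::
  "('x \<times> 'y) measure \<Rightarrow> ('w \<Rightarrow> 'y \<Rightarrow> real) \<Rightarrow> (('x \<Rightarrow> 'w) \<Rightarrow> real) \<Rightarrow> ('x \<Rightarrow> 'w) \<Rightarrow> ereal" where
  "pen_risk P l \<phi> f = expect P (\<lambda>z. ereal (pen_loss l \<phi> f z))"

definition risk_well_defined ::
  "('x \<times> 'y) measure \<Rightarrow> ('w \<Rightarrow> 'y \<Rightarrow> real) \<Rightarrow> ('x \<Rightarrow> 'w) \<Rightarrow> bool" where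
  "risk_well_defined P l g \<longleftrightarrow>
     quasi_integrable P (\<lambda>z. ereal (pred_loss l g z)) \<and> risk P l g \<noteq> - \<infinity>"

definition pen_excess_risk ::
  "('x \<times> 'y) measure \<Rightarrow> ('w \<Rightarrow> 'y \<Rightarrow> real) \<Rightarrow> (('x \<Rightarrow> 'w) \<Rightarrow> real) \<Rightarrow> ('x \<Rightarrow> 'w) set
    \<Rightarrow> ('x \<Rightarrow> 'w) \<Rightarrow> ereal" where
  "pen_excess_risk P l \<phi> F g = risk P l g - (INF f\<in>F. pen_risk P l \<phi> f)"

(* A sample of size n is a point of the product space indexed by {..<n}; adding the point z
   gives the sample s(n := z) of size n + 1, indexed by {..n}. *)

abbreviation sample_space :: "nat \<Rightarrow> ('x \<times> 'y) measure \<Rightarrow> (nat \<Rightarrow> 'x \<times> 'y) measure" where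
  "sample_space n P \<equiv> PiM {..<n} (\<lambda>_. P)"

(* fhat maps a sample t of size n + 1 to a minimizer over F of the penalized empirical risk
   on t; fhat (s(n := z)) is the minimizer for the sample s and the additional point z. *)

definition pen_erm ::
  "nat \<Rightarrow> ('x \<times> 'y) measure \<Rightarrow> ('w \<Rightarrow> 'y \<Rightarrow> real) \<Rightarrow> (('x \<Rightarrow> 'w) \<Rightarrow> real) \<Rightarrow> ('x \<Rightarrow> 'w) set
    \<Rightarrow> ((nat \<Rightarrow> 'x \<times> 'y) \<Rightarrow> 'x \<Rightarrow> 'w) \<Rightarrow> bool" where
  "pen_erm n P l \<phi> F fhat \<longleftrightarrow>
     (\<forall>s\<in>space (sample_space n P). \<forall>z\<in>space P.
        is_arg_min (\<lambda>f. (\<Sum>i<n. pen_loss l \<phi> f (s i)) + pen_loss l \<phi> f z) (\<lambda>f. f \<in> F)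
          (fhat (s(n := z))))"

definition symmetric_on_samples ::
  "nat \<Rightarrow> ('x \<times> 'y) measure \<Rightarrow> ((nat \<Rightarrow> 'x \<times> 'y) \<Rightarrow> 'x \<Rightarrow> 'w) \<Rightarrow> bool" where
  "symmetric_on_samples n P fhat \<longleftrightarrow>
     (\<forall>t\<in>space (PiM {..n} (\<lambda>_. P)). \<forall>\<pi>. \<pi> permutes {..n} \<longrightarrow> fhat (t \<circ> \<pi>) = fhat t)"

definition minmax_obj ::
  "nat \<Rightarrow> 'y measure \<Rightarrow> ('w \<Rightarrow> 'y \<Rightarrow> real) \<Rightarrow> (('x \<Rightarrow> 'w) \<Rightarrow> real)
    \<Rightarrow> ((nat \<Rightarrow> 'x \<times> 'y) \<Rightarrow> 'x \<Rightarrow> 'w) \<Rightarrow> (nat \<Rightarrow> 'x \<times> 'y) \<Rightarrow> 'x \<Rightarrow> 'w \<Rightarrow> ereal" where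
  "minmax_obj n MY l \<phi> fhat s x w =
     (SUP y\<in>space MY. ereal (l w y - pen_loss l \<phi> (fhat (s(n := (x, y)))) (x, y)))"

definition sample_predictor ::
  "nat \<Rightarrow> ('x \<times> 'y) measure \<Rightarrow> 'x measure \<Rightarrow> 'w measure
    \<Rightarrow> ((nat \<Rightarrow> 'x \<times> 'y) \<Rightarrow> 'x \<Rightarrow> 'w) \<Rightarrow> bool" where
  "sample_predictor n P MX MW g \<longleftrightarrow>
     (\<lambda>(s, x). g s x) \<in> measurable (sample_space n P \<Otimes>\<^sub>M MX) MW"

definition sample_minmax_predictor ::
  "nat \<Rightarrow> ('x \<times> 'y) measure \<Rightarrow> 'x measure \<Rightarrow> 'y measure \<Rightarrow> 'w measure
    \<Rightarrow> ('w \<Rightarrow> 'y \<Rightarrow> real) \<Rightarrow> (('x \<Rightarrow> 'w) \<Rightarrow> real) \<Rightarrow> ((nat \<Rightarrow> 'x \<times> 'y) \<Rightarrow> 'x \<Rightarrow> 'w)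
    \<Rightarrow> ((nat \<Rightarrow> 'x \<times> 'y) \<Rightarrow> 'x \<Rightarrow> 'w) \<Rightarrow> bool" where
  "sample_minmax_predictor n P MX MY MW l \<phi> fhat g \<longleftrightarrow>
     sample_predictor n P MX MW g \<and>
     (\<forall>s\<in>space (sample_space n P). \<forall>x\<in>space MX.
        is_arg_min (minmax_obj n MY l \<phi> fhat s x) (\<lambda>w. w \<in> space MW) (g s x))"

(* Law of (sample, X). It is used so that well-definedness of an expectation over (Z_1^n, X)
   requires measurability in (Z_1^n, X), not merely on the underlying probability space. *)

abbreviation sample_input_law ::
  "nat \<Rightarrow> ('x \<times> 'y) measure \<Rightarrow> 'x measure \<Rightarrow> ((nat \<Rightarrow> 'x \<times> 'y) \<times> 'x) measure" where
  "sample_input_law n P MX \<equiv> sample_space n P \<Otimes>\<^sub>M distr P MX fst"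

definition bound_well_defined ::
  "nat \<Rightarrow> ('x \<times> 'y) measure \<Rightarrow> 'x measure \<Rightarrow> 'y measure
    \<Rightarrow> ('w \<Rightarrow> 'y \<Rightarrow> real) \<Rightarrow> (('x \<Rightarrow> 'w) \<Rightarrow> real) \<Rightarrow> ((nat \<Rightarrow> 'x \<times> 'y) \<Rightarrow> 'x \<Rightarrow> 'w)
    \<Rightarrow> ((nat \<Rightarrow> 'x \<times> 'y) \<Rightarrow> 'x \<Rightarrow> 'w) \<Rightarrow> bool" where
  "bound_well_defined n P MX MY l \<phi> fhat g \<longleftrightarrow>
     quasi_integrable (sample_input_law n P MX) (\<lambda>(s, x). minmax_obj n MY l \<phi> fhat s x (g s x))"

(* The risks of the predictors g s are well defined for each sample s, and so is the joint
   expectation of the loss of g over the sample and the test point. The second condition is not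
   implied by the first one: without it, the expected risk, which is an iterated integral, need
   not be a joint integral. *)

definition expected_risk_well_defined ::
  "nat \<Rightarrow> ('x \<times> 'y) measure \<Rightarrow> ('w \<Rightarrow> 'y \<Rightarrow> real) \<Rightarrow> ((nat \<Rightarrow> 'x \<times> 'y) \<Rightarrow> 'x \<Rightarrow> 'w) \<Rightarrow> bool" where
  "expected_risk_well_defined n P l g \<longleftrightarrow>
     (\<forall>s\<in>space (sample_space n P). risk_well_defined P l (g s)) \<and>
     quasi_integrable (sample_space n P \<Otimes>\<^sub>M P) (\<lambda>(s, z). ereal (pred_loss l (g s) z))"

end

theory Submission
  imports Defs
begin

text \<open>
  For \<open>y = Y\<close> the supremum dominates \<open>\<ell>(g(X), Y) - \<ell>\<^sub>\<phi>(f\<^sup>Z, Z)\<close>, where \<open>f\<^sup>Z\<close> minimizes the penalized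
  empirical risk on all \<open>n + 1\<close> points. These points are exchangeable and the minimizer does not
  depend on their order, so averaging over which of them plays the role of the test point replaces
  \<open>\<ell>\<^sub>\<phi>(f\<^sup>Z, Z)\<close> by the minimal empirical risk, which is at most the empirical risk of any fixed
  \<open>f \<in> F\<close>, whose expectation is the penalized risk of \<open>f\<close>. The averaging takes place
  before integration, because the loss of the minimizer need not be measurable.
\<close>

section \<open>Extended-valued expectations: image measures and monotonicity\<close>

lemma expect_distr:
  assumes "T \<in> measurable N Q" and "h \<in> borel_measurable Q"
  shows "expect (distr N Q T) h = expect N (\<lambda>x. h (T x))"
  using assms unfolding expect_def by (subst (1 2) nn_integral_distr) auto

lemma expect_cong:
  "(\<And>x. x \<in> space N \<Longrightarrow> h x = k x) \<Longrightarrow> expect N h = expect N k"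
  unfolding expect_def by (simp cong: nn_integral_cong)

text \<open>Passing from \<open>h\<close> to \<open>k\<close>, the integral of the positive part can
  only grow and that of the negative part only shrink, and subtraction in \<open>ereal\<close>
  respects this even at infinite values. Optimality of the minmax predictor follows from it.\<close>

lemma expect_mono:
  assumes "\<And>x. x \<in> space N \<Longrightarrow> h x \<le> k x"
  shows "expect N h \<le> expect N k"
  unfolding expect_def
  using assms
  by (intro ereal_minus_mono)
    (auto simp: less_eq_ennreal.rep_eq[symmetric] intro!: nn_integral_mono e2ennreal_mono)

lemma quasi_integrable_distr:
  assumes "T \<in> measurable N Q" and "quasi_integrable (distr N Q T) h"
  shows "quasi_integrable N (\<lambda>x. h (T x))"
proof -
  have h: "h \<in> borel_measurable Q"
    using assms(2) by (auto simp: quasi_integrable_def)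
  show ?thesis
    using assms(2) unfolding quasi_integrable_def
    by (subst (asm) (1 2) nn_integral_distr) (use assms(1) h in auto)
qed

section \<open>Expectations of differences of nonnegative functions\<close>

text \<open>The decomposition of a difference into its positive and negative part, written with sums
  only, so that both sides can be integrated before anything is subtracted.\<close>

lemma ennreal_parts_of_diff:
  fixes a b :: ennreal
  assumes "a \<noteq> top \<or> b \<noteq> top"
  shows "e2ennreal (enn2ereal a - enn2ereal b) + b = a + e2ennreal (- (enn2ereal a - enn2ereal b))"
proof (cases a; cases b)
  fix r s :: real
  assume r: "0 \<le> r" "a = ennreal r" and s: "0 \<le> s" "b = ennreal s"
  have "ennreal (r - s) + ennreal s = ennreal r + ennreal (s - r)"
    using r s by (cases "s \<le> r") (simp_all add: ennreal_neg flip: ennreal_plus)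
  then show ?thesis using r s by simp
qed (use assms in auto)

text \<open>If \<open>p\<close> is finite, so is \<open>a\<close>; if \<open>q\<close> is finite, so
  is \<open>b\<close>. Hence infinity minus infinity never arises when terms are moved across
  \<open>eq\<close>.\<close>

lemma ennreal_diff_eq_diff:
  fixes a b p q :: ennreal
  assumes eq: "a + q = p + b" and le: "a \<le> p" "b \<le> q" and fin: "p \<noteq> top \<or> q \<noteq> top"
  shows "enn2ereal a - enn2ereal b = enn2ereal p - enn2ereal q"
proof -
  have eq': "enn2ereal a + enn2ereal q = enn2ereal p + enn2ereal b"
    using eq by (simp flip: plus_ennreal.rep_eq)
  have le': "enn2ereal a \<le> enn2ereal p" "enn2ereal b \<le> enn2ereal q"
    using le by (simp_all add: less_eq_ennreal.rep_eq)
  have fin': "enn2ereal p \<noteq> \<infinity> \<or> enn2ereal q \<noteq> \<infinity>"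
    using fin by simp
  have pos: "0 \<le> enn2ereal a" "0 \<le> enn2ereal b" "0 \<le> enn2ereal p" "0 \<le> enn2ereal q"
    by simp_all
  show ?thesis
    using eq' le' fin' pos
    by (cases "enn2ereal p"; cases "enn2ereal q"; cases "enn2ereal a"; cases "enn2ereal b") simp_all
qed

text \<open>\<open>p\<close> and \<open>q\<close> may both be positive at a point, so they can
  differ from the positive and negative part of their difference, which \<open>expect\<close>
  integrates. Almost everywhere one of them is finite; integrating
  \<open>ennreal_parts_of_diff\<close> then links the two representations.\<close>

lemma expect_diff:
  assumes [measurable]: "p \<in> borel_measurable N" "q \<in> borel_measurable N"
    and fin: "(\<integral>\<^sup>+ x. p x \<partial>N) < \<infinity> \<or> (\<integral>\<^sup>+ x. q x \<partial>N) < \<infinity>"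
  shows "expect N (\<lambda>x. enn2ereal (p x) - enn2ereal (q x))
    = enn2ereal (\<integral>\<^sup>+ x. p x \<partial>N) - enn2ereal (\<integral>\<^sup>+ x. q x \<partial>N)"
proof -
  let ?h = "\<lambda>x. enn2ereal (p x) - enn2ereal (q x)"
  define A where "A = (\<integral>\<^sup>+ x. e2ennreal (?h x) \<partial>N)"
  define B where "B = (\<integral>\<^sup>+ x. e2ennreal (- ?h x) \<partial>N)"
  define p' where "p' = (\<integral>\<^sup>+ x. p x \<partial>N)"
  define q' where "q' = (\<integral>\<^sup>+ x. q x \<partial>N)"
  have "AE x in N. p x \<noteq> top \<or> q x \<noteq> top"
    using fin
  proof
    assume "(\<integral>\<^sup>+ x. p x \<partial>N) < \<infinity>"
    then have "AE x in N. p x \<noteq> \<infinity>" by (intro nn_integral_noteq_infinite) auto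
    then show ?thesis by eventually_elim simp
  next
    assume "(\<integral>\<^sup>+ x. q x \<partial>N) < \<infinity>"
    then have "AE x in N. q x \<noteq> \<infinity>" by (intro nn_integral_noteq_infinite) auto
    then show ?thesis by eventually_elim simp
  qed
  then have "AE x in N. e2ennreal (?h x) + q x = p x + e2ennreal (- ?h x)"
    by eventually_elim (rule ennreal_parts_of_diff)
  then have "(\<integral>\<^sup>+ x. (e2ennreal (?h x) + q x) \<partial>N) = (\<integral>\<^sup>+ x. (p x + e2ennreal (- ?h x)) \<partial>N)"
    by (rule nn_integral_cong_AE)
  then have eq: "A + q' = p' + B"
    unfolding A_def B_def p'_def q'_def by (simp add: nn_integral_add)
  have "e2ennreal (enn2ereal a - enn2ereal b) \<le> a" for a b
    using e2ennreal_mono[of "enn2ereal a - enn2ereal b" "enn2ereal a"]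
      ereal_diff_le_self[of "enn2ereal b" "enn2ereal a"] by simp
  then have "A \<le> p'"
    unfolding A_def p'_def by (intro nn_integral_mono) auto
  have "e2ennreal (- (enn2ereal a - enn2ereal b)) \<le> b" for a b
  proof -
    have "- (enn2ereal a - enn2ereal b) \<le> enn2ereal b"
      using enn2ereal_nonneg[of a] enn2ereal_nonneg[of b]
      by (cases "enn2ereal a"; cases "enn2ereal b") simp_all
    from e2ennreal_mono[OF this] show ?thesis by simp
  qed
  then have "B \<le> q'"
    unfolding B_def q'_def by (intro nn_integral_mono) auto
  have "enn2ereal A - enn2ereal B = enn2ereal p' - enn2ereal q'"
    using eq \<open>A \<le> p'\<close> \<open>B \<le> q'\<close> fin unfolding p'_def[symmetric] q'_def[symmetric]
    by (intro ennreal_diff_eq_diff) auto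
  then show ?thesis
    unfolding expect_def A_def B_def p'_def q'_def .
qed

text \<open>\<open>ennreal\<close> sends negative reals to 0, so \<open>ennreal r\<close> and
  \<open>ennreal (- r)\<close> are the positive and negative part of \<open>r\<close>; subtracting
  \<open>r\<close> adds the former to \<open>q\<close> and the latter to \<open>p\<close>.\<close>

lemma ennreal_diff_shift:
  fixes p q :: ennreal
  assumes "p \<noteq> top \<or> q \<noteq> top"
  shows "enn2ereal p - enn2ereal q - ereal r
    = enn2ereal (p + ennreal (- r)) - enn2ereal (q + ennreal r)"
proof -
  have "enn2ereal (ennreal x) = ereal (max 0 x)" for x
    by (simp add: max_def ennreal_neg enn2ereal_ennreal zero_ennreal.rep_eq)
  then show ?thesis
    using assms enn2ereal_nonneg[of p] enn2ereal_nonneg[of q]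
    by (cases "enn2ereal p"; cases "enn2ereal q") (auto simp: plus_ennreal.rep_eq max_def)
qed

text \<open>Tonelli's theorem, applied to the positive and the negative part of \<open>L\<close>
  separately. It turns the expected excess risk, an iterated expectation, into a joint expectation
  of the loss minus the infimal penalized risk.\<close>

lemma expect_iterated_diff_const:
  fixes L :: "'s \<times> 'z \<Rightarrow> ereal" and c :: ereal
  assumes "prob_space N" and "prob_space Q"
    and qi: "quasi_integrable (N \<Otimes>\<^sub>M Q) L" and c: "\<bar>c\<bar> \<noteq> \<infinity>"
    and inner: "\<And>s. s \<in> space N \<Longrightarrow> expect Q (\<lambda>z. L (s, z)) \<noteq> - \<infinity>"
      "\<And>s. s \<in> space N \<Longrightarrow> quasi_integrable Q (\<lambda>z. L (s, z))"
  shows "expect N (\<lambda>s. expect Q (\<lambda>z. L (s, z)) - c) = expect (N \<Otimes>\<^sub>M Q) L - c"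
    and "(\<lambda>s. expect Q (\<lambda>z. L (s, z)) - c) \<in> borel_measurable N"
proof -
  interpret N: prob_space N by fact
  interpret Q: prob_space Q by fact
  have L[measurable]: "L \<in> borel_measurable (N \<Otimes>\<^sub>M Q)"
    using qi by (simp add: quasi_integrable_def)
  obtain r where r: "c = ereal r" using c by (cases c) auto
  define p where "p = (\<lambda>s. \<integral>\<^sup>+ z. e2ennreal (L (s, z)) \<partial>Q)"
  define q where "q = (\<lambda>s. \<integral>\<^sup>+ z. e2ennreal (- L (s, z)) \<partial>Q)"
  have pq[measurable]: "p \<in> borel_measurable N" "q \<in> borel_measurable N"
    unfolding p_def q_def by measurable
  have P: "(\<integral>\<^sup>+ s. p s \<partial>N) = (\<integral>\<^sup>+ x. e2ennreal (L x) \<partial>(N \<Otimes>\<^sub>M Q))"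
    unfolding p_def by (subst Q.nn_integral_fst[symmetric]) auto
  have Q: "(\<integral>\<^sup>+ s. q s \<partial>N) = (\<integral>\<^sup>+ x. e2ennreal (- L x) \<partial>(N \<Otimes>\<^sub>M Q))"
    unfolding q_def by (subst Q.nn_integral_fst[symmetric]) auto
  show "(\<lambda>s. expect Q (\<lambda>z. L (s, z)) - c) \<in> borel_measurable N"
    using pq unfolding expect_def p_def[symmetric] q_def[symmetric]
    by (simp add: p_def[symmetric] q_def[symmetric] fun_eq_iff)
  \<comment> \<open>If \<open>q s\<close> were infinite, quasi-integrability would make
    \<open>p s\<close> finite and the inner expectation minus infinity, which is excluded.\<close>
  have q_fin: "q s \<noteq> top" if "s \<in> space N" for s
  proof
    assume "q s = top"
    then have "p s \<noteq> top"
      using inner(2)[OF that] unfolding quasi_integrable_def p_def q_def by auto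
    then have "enn2ereal (p s) - enn2ereal (q s) = - \<infinity>"
      using \<open>q s = top\<close> by (cases "p s") auto
    then show False
      using inner(1)[OF that] by (simp add: expect_def p_def q_def)
  qed
  have "expect N (\<lambda>s. expect Q (\<lambda>z. L (s, z)) - c)
      = expect N (\<lambda>s. enn2ereal (p s + ennreal (- r)) - enn2ereal (q s + ennreal r))"
  proof (rule expect_cong)
    fix s assume "s \<in> space N"
    then show "expect Q (\<lambda>z. L (s, z)) - c
        = enn2ereal (p s + ennreal (- r)) - enn2ereal (q s + ennreal r)"
      using q_fin[of s] ennreal_diff_shift[of "p s" "q s" r]
      by (simp add: expect_def p_def q_def r)
  qed
  also have "\<dots> = enn2ereal (\<integral>\<^sup>+ s. p s + ennreal (- r) \<partial>N) - enn2ereal (\<integral>\<^sup>+ s. q s + ennreal r \<partial>N)"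
    using qi by (intro expect_diff)
      (auto simp: quasi_integrable_def P Q nn_integral_add N.emeasure_space_1)
  also have "\<dots> = enn2ereal (\<integral>\<^sup>+ s. p s \<partial>N) - enn2ereal (\<integral>\<^sup>+ s. q s \<partial>N) - c"
    using qi
    by (simp add: quasi_integrable_def P Q nn_integral_add N.emeasure_space_1 r
        ennreal_diff_shift[symmetric] less_top)
  finally show "expect N (\<lambda>s. expect Q (\<lambda>z. L (s, z)) - c) = expect (N \<Otimes>\<^sub>M Q) L - c"
    by (simp add: expect_def P Q)
qed

section \<open>The symmetrization inequality\<close>

lemma ennreal_diff_le_diff_add_diff:
  fixes l1 l2 b1 b2 h1 h2 :: ennreal
  assumes le: "l1 + b2 + h2 \<le> b1 + h1 + l2"
    and h: "h1 \<noteq> top" "h2 \<noteq> top"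
    and l: "l1 \<noteq> top \<or> l2 \<noteq> top" and b: "b1 \<noteq> top \<or> b2 \<noteq> top"
  shows "enn2ereal l1 - enn2ereal l2 \<le> (enn2ereal b1 - enn2ereal b2) + (enn2ereal h1 - enn2ereal h2)"
proof -
  obtain r1 r2 where r: "enn2ereal h1 = ereal r1" "enn2ereal h2 = ereal r2"
    using h by (metis enn2ereal_ennreal enn2real_nonneg ennreal_enn2real less_top)
  \<comment> \<open>An infinite \<open>b1\<close> makes the right side infinite, and an infinite
    \<open>l2\<close> makes the left side minus infinity; otherwise \<open>le\<close> forces all six
    terms to be finite.\<close>
  show ?thesis
  proof (cases "b1 = top \<or> l2 = top")
    case True
    then show ?thesis
    proof
      assume "b1 = top"
      then show ?thesis using b r by (cases b2) auto
    next
      assume "l2 = top"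
      then show ?thesis using l by (cases l1) auto
    qed
  next
    case False
    then have "b1 + h1 + l2 \<noteq> top" using h by simp
    then have "l1 + b2 + h2 \<noteq> top" using le by (auto simp: top_unique)
    then have fin: "l1 \<noteq> top" "b2 \<noteq> top" by auto
    have "enn2ereal l1 + enn2ereal b2 + enn2ereal h2 \<le> enn2ereal b1 + enn2ereal h1 + enn2ereal l2"
      using le by (simp add: less_eq_ennreal.rep_eq plus_ennreal.rep_eq)
    moreover obtain x1 x2 y1 y2 where "enn2ereal l1 = ereal x1" "enn2ereal l2 = ereal x2"
        "enn2ereal b1 = ereal y1" "enn2ereal b2 = ereal y2"
      using fin False by (metis enn2ereal_ennreal enn2real_nonneg ennreal_enn2real less_top)
    ultimately show ?thesis using r by simp
  qed
qed

text \<open>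
  The summed inequality is rearranged so that both sides are sums of positive and negative parts
  before it is integrated; hence \<open>L\<close> and \<open>B\<close> need only be quasi-integrable. No measurability is
  required of \<open>\<psi>\<close>, which will be the loss of the empirical minimizer.
\<close>

lemma expect_le_by_symmetrization:
  fixes L h :: "'q \<Rightarrow> real" and B :: "'q \<Rightarrow> ereal" and T :: "'i \<Rightarrow> 't \<Rightarrow> 'q"
  assumes I: "finite I" "I \<noteq> {}"
    and T: "\<And>i. i \<in> I \<Longrightarrow> T i \<in> measurable N Q" "\<And>i. i \<in> I \<Longrightarrow> distr N Q (T i) = Q"
    and qi: "quasi_integrable Q (\<lambda>x. ereal (L x))" "quasi_integrable Q B"
    and h: "h \<in> borel_measurable Q" "\<bar>expect Q (\<lambda>x. ereal (h x))\<bar> \<noteq> \<infinity>"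
    and pw: "\<And>t. t \<in> space N \<Longrightarrow>
      \<exists>\<psi>. (\<forall>i\<in>I. ereal (L (T i t) - \<psi> i) \<le> B (T i t)) \<and> (\<Sum>i\<in>I. \<psi> i) \<le> (\<Sum>i\<in>I. h (T i t))"
  shows "expect Q (\<lambda>x. ereal (L x)) \<le> expect Q B + expect Q (\<lambda>x. ereal (h x))"
proof -
  have [measurable]: "(\<lambda>x. ereal (L x)) \<in> borel_measurable Q" "B \<in> borel_measurable Q"
    "h \<in> borel_measurable Q"
    using qi h by (auto simp: quasi_integrable_def)
  have [measurable]: "L \<in> borel_measurable Q"
    using borel_measurable_real_of_ereal[of "\<lambda>x. ereal (L x)" Q] by simp
  define l1 l2 where "l1 = (\<integral>\<^sup>+ x. ennreal (L x) \<partial>Q)" and "l2 = (\<integral>\<^sup>+ x. ennreal (- L x) \<partial>Q)"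
  define b1 b2 where "b1 = (\<integral>\<^sup>+ x. e2ennreal (B x) \<partial>Q)" and "b2 = (\<integral>\<^sup>+ x. e2ennreal (- B x) \<partial>Q)"
  define h1 h2 where "h1 = (\<integral>\<^sup>+ x. ennreal (h x) \<partial>Q)" and "h2 = (\<integral>\<^sup>+ x. ennreal (- h x) \<partial>Q)"
  \<comment> \<open>\<open>?u x \<le> ?v x\<close> is \<open>L x \<le> B x + h x\<close> with all
    negative parts moved across. It may fail at a single point and is available only after summing
    over the points \<open>T i t\<close>.\<close>
  let ?u = "\<lambda>x. ennreal (L x) + e2ennreal (- B x) + ennreal (- h x)"
  let ?v = "\<lambda>x. e2ennreal (B x) + ennreal (h x) + ennreal (- L x)"
  \<comment> \<open>Every \<open>T i\<close> carries \<open>N\<close> to the law \<open>Q\<close>,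
    so the \<open>card I\<close> summands have the same integral; this factor is cancelled at the
    end.\<close>
  have inv: "(\<integral>\<^sup>+ t. (\<Sum>i\<in>I. k (T i t)) \<partial>N) = of_nat (card I) * (\<integral>\<^sup>+ x. k x \<partial>Q)"
    if [measurable]: "k \<in> borel_measurable Q" for k :: "'q \<Rightarrow> ennreal"
  proof -
    have "(\<integral>\<^sup>+ t. (\<Sum>i\<in>I. k (T i t)) \<partial>N) = (\<Sum>i\<in>I. \<integral>\<^sup>+ t. k (T i t) \<partial>N)"
      using T(1) that by (intro nn_integral_sum) (auto intro: measurable_compose)
    also have "\<dots> = (\<Sum>i\<in>I. \<integral>\<^sup>+ x. k x \<partial>Q)"
    proof (rule sum.cong)
      fix i assume i: "i \<in> I"
      have "(\<integral>\<^sup>+ t. k (T i t) \<partial>N) = (\<integral>\<^sup>+ x. k x \<partial>distr N Q (T i))"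
        using T(1)[OF i] that by (simp add: nn_integral_distr)
      then show "(\<integral>\<^sup>+ t. k (T i t) \<partial>N) = (\<integral>\<^sup>+ x. k x \<partial>Q)"
        by (simp add: T(2)[OF i])
    qed simp
    finally show ?thesis by simp
  qed
  have sums: "(\<Sum>i\<in>I. ?u (T i t)) \<le> (\<Sum>i\<in>I. ?v (T i t))" if t: "t \<in> space N" for t
  proof (cases "\<exists>i\<in>I. B (T i t) = \<infinity>")
    case True
    then obtain i where i: "i \<in> I" "B (T i t) = \<infinity>" by blast
    have "?v (T i t) \<le> (\<Sum>i\<in>I. ?v (T i t))"
      by (intro member_le_sum) (use I i in auto)
    then show ?thesis using i by (simp add: top_unique)
  next
    case False
    obtain \<psi> where \<psi>: "\<And>i. i \<in> I \<Longrightarrow> ereal (L (T i t) - \<psi> i) \<le> B (T i t)"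
        "(\<Sum>i\<in>I. \<psi> i) \<le> (\<Sum>i\<in>I. h (T i t))"
      using pw[OF t] by blast
    define b where "b = (\<lambda>i. real_of_ereal (B (T i t)))"
    \<comment> \<open>The real lower bound rules out minus infinity, and the case distinction rules
      out plus infinity.\<close>
    have Bb: "B (T i t) = ereal (b i)" if "i \<in> I" for i
      using \<psi>(1)[OF that] False that unfolding b_def by (cases "B (T i t)") auto
    let ?a = "\<lambda>i. max 0 (L (T i t)) + max 0 (- b i) + max 0 (- h (T i t))"
    let ?c = "\<lambda>i. max 0 (b i) + max 0 (h (T i t)) + max 0 (- L (T i t))"
    have "(\<Sum>i\<in>I. L (T i t) - \<psi> i) \<le> (\<Sum>i\<in>I. b i)"
      using \<psi>(1) Bb by (intro sum_mono) auto
    \<comment> \<open>The \<open>\<psi> i\<close> enter through their sum alone, which is replaced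
      by that of \<open>h\<close>.\<close>
    then have "0 \<le> (\<Sum>i\<in>I. b i + h (T i t) - L (T i t))"
      using \<psi>(2) by (simp add: sum.distrib sum_subtractf)
    also have "\<dots> = (\<Sum>i\<in>I. ?c i - ?a i)"
      by (intro sum.cong) (auto simp: max_def)
    finally have le: "(\<Sum>i\<in>I. ?a i) \<le> (\<Sum>i\<in>I. ?c i)"
      by (simp add: sum_subtractf)
    have pos: "ennreal x + ennreal y + ennreal z = ennreal (max 0 x + max 0 y + max 0 z)" for x y z
      by simp
    have "(\<Sum>i\<in>I. ?u (T i t)) = (\<Sum>i\<in>I. ennreal (?a i))"
      by (intro sum.cong) (simp_all add: Bb pos del: ennreal_plus ennreal_max_0 ennreal_max_0')
    also have "\<dots> \<le> (\<Sum>i\<in>I. ennreal (?c i))"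
    proof -
      have "(\<Sum>i\<in>I. ennreal (?a i)) = ennreal (\<Sum>i\<in>I. ?a i)"
        and "(\<Sum>i\<in>I. ennreal (?c i)) = ennreal (\<Sum>i\<in>I. ?c i)"
        by (intro sum_ennreal; simp)+
      with ennreal_leI[OF le] show ?thesis by presburger
    qed
    also have "\<dots> = (\<Sum>i\<in>I. ?v (T i t))"
      by (intro sum.cong) (simp_all add: Bb pos del: ennreal_plus ennreal_max_0 ennreal_max_0')
    finally show ?thesis .
  qed
  have "of_nat (card I) * (\<integral>\<^sup>+ x. ?u x \<partial>Q) \<le> of_nat (card I) * (\<integral>\<^sup>+ x. ?v x \<partial>Q)"
  proof -
    have "(\<integral>\<^sup>+ t. (\<Sum>i\<in>I. ?u (T i t)) \<partial>N) \<le> (\<integral>\<^sup>+ t. (\<Sum>i\<in>I. ?v (T i t)) \<partial>N)"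
      by (intro nn_integral_mono sums)
    moreover have m: "?u \<in> borel_measurable Q" "?v \<in> borel_measurable Q"
      by measurable
    ultimately show ?thesis
      by (simp only: inv[OF m(1)] inv[OF m(2)])
  qed
  then have "(\<integral>\<^sup>+ x. ?u x \<partial>Q) \<le> (\<integral>\<^sup>+ x. ?v x \<partial>Q)"
    using I by (subst (asm) ennreal_mult_le_mult_iff) (auto simp: card_gt_0_iff)
  then have main: "l1 + b2 + h2 \<le> b1 + h1 + l2"
    unfolding l1_def l2_def b1_def b2_def h1_def h2_def by (simp add: nn_integral_add)
  have "h1 \<noteq> top" "h2 \<noteq> top"
    using h(2) unfolding expect_def h1_def h2_def by (cases h1; cases h2; auto simp: h1_def h2_def)+
  moreover have "l1 \<noteq> top \<or> l2 \<noteq> top" "b1 \<noteq> top \<or> b2 \<noteq> top"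
    using qi unfolding quasi_integrable_def l1_def l2_def b1_def b2_def by auto
  ultimately have "enn2ereal l1 - enn2ereal l2
      \<le> (enn2ereal b1 - enn2ereal b2) + (enn2ereal h1 - enn2ereal h2)"
    using main by (intro ennreal_diff_le_diff_add_diff) auto
  then show ?thesis
    by (simp add: expect_def l1_def l2_def b1_def b2_def h1_def h2_def)
qed

section \<open>Exchangeability and splitting off the last point\<close>

lemma distr_PiM_permute:
  assumes "prob_space P" and "\<pi> permutes I"
  shows "distr (PiM I (\<lambda>_. P)) (PiM I (\<lambda>_. P)) (\<lambda>t. \<lambda>i\<in>I. t (\<pi> i)) = PiM I (\<lambda>_. P)"
  using assms distr_PiM_reindex[of I "\<lambda>_. P" \<pi> I]
  by (auto simp: permutes_inj_on permutes_in_image)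

lemma measurable_PiM_permute:
  assumes "\<pi> permutes I"
  shows "(\<lambda>t. \<lambda>i\<in>I. t (\<pi> i)) \<in> measurable (PiM I (\<lambda>_. P)) (PiM I (\<lambda>_. P))"
  using assms by (intro measurable_restrict measurable_component_singleton) (simp add: permutes_in_image)

lemma measurable_split_last:
  "(\<lambda>t. (restrict t {..<n}, t n)) \<in> measurable (PiM {..n} (\<lambda>_. P)) (PiM {..<n} (\<lambda>_. P) \<Otimes>\<^sub>M P)"
  for n :: nat
  by (intro measurable_Pair measurable_restrict_subset measurable_component_singleton) auto

text \<open>Inserting coordinate \<open>n\<close> carries the product of \<open>P\<close> and the
  law of the first \<open>n\<close> points to the law of all \<open>n + 1\<close> points. Splitting
  after inserting only swaps the two factors, and the swap turns one product into the other.\<close>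

lemma distr_split_last:
  fixes n :: nat
  assumes "prob_space P"
  shows "distr (PiM {..n} (\<lambda>_. P)) (PiM {..<n} (\<lambda>_. P) \<Otimes>\<^sub>M P) (\<lambda>t. (restrict t {..<n}, t n))
    = PiM {..<n} (\<lambda>_. P) \<Otimes>\<^sub>M P"
    (is "distr ?N ?Q ?T = ?Q")
proof -
  let ?R = "PiM {..<n} (\<lambda>_. P)"
  interpret P: prob_space P by fact
  interpret R: prob_space ?R by (intro prob_space_PiM assms)
  interpret PR: pair_sigma_finite ?R P ..
  have ins: "insert n {..<n} = {..n}" by auto
  have N: "?N = distr (P \<Otimes>\<^sub>M ?R) ?N (\<lambda>(x, X). X(n := x))"
    using distr_pair_PiM_eq_PiM[of "{..<n}" "\<lambda>_. P" n] assms by (simp add: ins)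
  have m: "(\<lambda>(x, X). X(n := x)) \<in> measurable (P \<Otimes>\<^sub>M ?R) ?N"
    unfolding ins[symmetric] by measurable
  have "distr ?N ?Q ?T = distr (distr (P \<Otimes>\<^sub>M ?R) ?N (\<lambda>(x, X). X(n := x))) ?Q ?T"
    using N by simp
  also have "\<dots> = distr (P \<Otimes>\<^sub>M ?R) ?Q (?T \<circ> (\<lambda>(x, X). X(n := x)))"
    by (rule distr_distr[OF measurable_split_last m])
  also have "\<dots> = distr (P \<Otimes>\<^sub>M ?R) ?Q (\<lambda>(x, y). (y, x))"
  proof (rule distr_cong)
    fix v assume "v \<in> space (P \<Otimes>\<^sub>M ?R)"
    then show "(?T \<circ> (\<lambda>(x, X). X(n := x))) v = (case v of (x, y) \<Rightarrow> (y, x))"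
      by (auto simp: space_pair_measure space_PiM PiE_def extensional_def fun_eq_iff)
  qed simp_all
  also have "\<dots> = ?Q"
    by (rule PR.distr_pair_swap[symmetric])
  finally show ?thesis .
qed

section \<open>Comparison with a fixed predictor of the class\<close>

lemma expected_risk_le:
  fixes P :: "('x \<times> 'y) measure" and l :: "'w \<Rightarrow> 'y \<Rightarrow> real"
  assumes P: "prob_space P" "sets P = sets (MX \<Otimes>\<^sub>M MY)"
    and fhat: "pen_erm n P l \<phi> F fhat" "symmetric_on_samples n P fhat"
    and L: "quasi_integrable (sample_space n P \<Otimes>\<^sub>M P) (\<lambda>v. ereal (pred_loss l (g (fst v)) (snd v)))"
    and B: "quasi_integrable (sample_space n P \<Otimes>\<^sub>M P)
      (\<lambda>v. minmax_obj n MY l \<phi> fhat (fst v) (fst (snd v)) (g (fst v) (fst (snd v))))"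
    and f: "f \<in> F" "(\<lambda>z. pen_loss l \<phi> f z) \<in> borel_measurable P" "\<bar>pen_risk P l \<phi> f\<bar> \<noteq> \<infinity>"
  shows "expect (sample_space n P \<Otimes>\<^sub>M P) (\<lambda>v. ereal (pred_loss l (g (fst v)) (snd v)))
    \<le> expect (sample_space n P \<Otimes>\<^sub>M P)
        (\<lambda>v. minmax_obj n MY l \<phi> fhat (fst v) (fst (snd v)) (g (fst v) (fst (snd v))))
      + pen_risk P l \<phi> f"
proof -
  let ?Q = "sample_space n P \<Otimes>\<^sub>M P"
  let ?N = "PiM {..n} (\<lambda>_. P)"
  interpret P: prob_space P by fact
  interpret R: prob_space "sample_space n P" by (intro prob_space_PiM P)
  have spP: "space P = space MX \<times> space MY"
    using sets_eq_imp_space_eq[OF P(2)] by (simp add: space_pair_measure)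
  \<comment> \<open>Exchanging points \<open>i\<close> and \<open>n\<close> lets point
    \<open>i\<close> play the role of the test point; \<open>i = n\<close> leaves the sample as it
    is.\<close>
  define swap where "swap i t = (\<lambda>j\<in>{..n}. t (Transposition.transpose i n j))" for i and t :: "nat \<Rightarrow> 'x \<times> 'y"
  define T where "T i t = (restrict (swap i t) {..<n}, swap i t n)" for i and t :: "nat \<Rightarrow> 'x \<times> 'y"
  have perm: "Transposition.transpose i n permutes {..n}" if "i \<in> {..n}" for i
    using that by (intro permutes_swap_id) auto
  have swap_m: "swap i \<in> measurable ?N ?N" if "i \<in> {..n}" for i
    using measurable_PiM_permute[OF perm[OF that]] unfolding swap_def[abs_def] .
  have T_comp: "T i = (\<lambda>t. (restrict t {..<n}, t n)) \<circ> swap i" for i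
    by (simp add: T_def[abs_def] fun_eq_iff)
  have T: "T i \<in> measurable ?N ?Q" if "i \<in> {..n}" for i
    unfolding T_comp by (rule measurable_comp[OF swap_m[OF that] measurable_split_last])
  have T': "distr ?N ?Q (T i) = ?Q" if "i \<in> {..n}" for i
  proof -
    have "distr ?N ?N (swap i) = ?N"
      using distr_PiM_permute[OF P(1) perm[OF that]] unfolding swap_def[abs_def] .
    then show ?thesis
      using distr_distr[OF measurable_split_last swap_m[OF that]] distr_split_last[OF P(1), of n]
      unfolding T_comp by simp
  qed
  have snd_T: "snd (T i t) = t i" for i t
    by (simp add: T_def swap_def)
  have pr: "pen_risk P l \<phi> f = expect ?Q (\<lambda>v. ereal (pen_loss l \<phi> f (snd v)))"
  proof -
    have "(\<integral>\<^sup>+ v. ennreal (k (snd v)) \<partial>?Q) = (\<integral>\<^sup>+ z. ennreal (k z) \<partial>P)"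
      if [measurable]: "k \<in> borel_measurable P" for k :: "'x \<times> 'y \<Rightarrow> real"
      by (subst P.nn_integral_fst[symmetric]) (simp_all add: R.emeasure_space_1)
    from this[of "pen_loss l \<phi> f"] this[of "\<lambda>z. - pen_loss l \<phi> f z"] show ?thesis
      using f(2) by (simp add: pen_risk_def expect_def)
  qed
  show ?thesis
    unfolding pr
  proof (rule expect_le_by_symmetrization[where I = "{..n}" and T = T and N = ?N])
    show "(\<lambda>v. pen_loss l \<phi> f (snd v)) \<in> borel_measurable ?Q"
      using f(2) by measurable
    show "\<bar>expect ?Q (\<lambda>v. ereal (pen_loss l \<phi> f (snd v)))\<bar> \<noteq> \<infinity>"
      using f(3) pr by simp
    fix t assume t: "t \<in> space ?N"
    have tP: "t i \<in> space P" if "i \<le> n" for i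
      using t that by (auto simp: space_PiM)
    show "\<exists>\<psi>. (\<forall>i\<in>{..n}. ereal (pred_loss l (g (fst (T i t))) (snd (T i t)) - \<psi> i)
          \<le> minmax_obj n MY l \<phi> fhat (fst (T i t)) (fst (snd (T i t))) (g (fst (T i t)) (fst (snd (T i t)))))
        \<and> (\<Sum>i\<in>{..n}. \<psi> i) \<le> (\<Sum>i\<in>{..n}. pen_loss l \<phi> f (snd (T i t)))"
    \<comment> \<open>The witness at \<open>i\<close> is the loss at point \<open>i\<close> of the
      minimizer for all \<open>n + 1\<close> points, the same function whichever point serves as
      test point.\<close>
    proof (intro exI[of _ "\<lambda>i. pen_loss l \<phi> (fhat t) (t i)"] conjI ballI)
      fix i assume i: "i \<in> {..n}"
      \<comment> \<open>Outside \<open>{..n}\<close> both sides are \<open>undefined\<close>,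
        because \<open>t\<close> is extensional and the transposition fixes these indices. Symmetry
        is stated for compositions, hence this form.\<close>
      have "swap i t = t \<circ> Transposition.transpose i n"
        using t i unfolding swap_def
        by (auto simp: fun_eq_iff space_PiM PiE_def extensional_def Transposition.transpose_def)
      then have sym: "fhat (swap i t) = fhat t"
        using fhat(2) t perm[OF i] by (simp add: symmetric_on_samples_def)
      have upd: "(fst (T i t))(n := t i) = swap i t"
        unfolding T_def by (auto simp: swap_def fun_eq_iff)
      \<comment> \<open>The actual label \<open>snd (t i)\<close> is one of the \<open>y\<close> in
        the supremum; \<open>upd\<close> and \<open>sym\<close> identify the minimizer occurring
        there with \<open>fhat t\<close>.\<close>
      show "ereal (pred_loss l (g (fst (T i t))) (snd (T i t)) - pen_loss l \<phi> (fhat t) (t i))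
          \<le> minmax_obj n MY l \<phi> fhat (fst (T i t)) (fst (snd (T i t))) (g (fst (T i t)) (fst (snd (T i t))))"
        unfolding minmax_obj_def
        by (rule SUP_upper2[of "snd (t i)"])
          (use tP[of i] i in \<open>auto simp: snd_T spP upd sym pred_loss_def\<close>)
    next
      \<comment> \<open>\<open>pen_erm\<close> speaks of samples \<open>s(n := z)\<close>, so
        \<open>t\<close> is written as its first \<open>n\<close> points updated at
        \<open>n\<close>.\<close>
      have "restrict t {..<n} \<in> space (sample_space n P)"
        using t by (auto simp: space_PiM)
      moreover have "(restrict t {..<n})(n := t n) = t"
        using t by (auto simp: space_PiM PiE_def extensional_def fun_eq_iff)
      ultimately have "(\<Sum>i<n. pen_loss l \<phi> (fhat t) (t i)) + pen_loss l \<phi> (fhat t) (t n)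
          \<le> (\<Sum>i<n. pen_loss l \<phi> f (t i)) + pen_loss l \<phi> f (t n)"
        using fhat(1) f(1) tP[of n] unfolding pen_erm_def is_arg_min_def
        by (force simp: not_less)
      then show "(\<Sum>i\<in>{..n}. pen_loss l \<phi> (fhat t) (t i)) \<le> (\<Sum>i\<in>{..n}. pen_loss l \<phi> f (snd (T i t)))"
        by (simp add: snd_T flip: lessThan_Suc_atMost)
    qed
  qed (use T T' L B in auto)
qed

section \<open>From random variables to product laws\<close>

text \<open>\<open>Z n\<close> serves as the test point. Joint independence of all
  \<open>n + 1\<close> variables also contains its independence from the sample.\<close>

lemma iid_split_last:
  fixes n :: nat
  assumes M: "prob_space M" and P: "prob_space P"
    and iid: "prob_space.indep_vars M (\<lambda>_. P) Z {..n}" "\<And>i. i \<le> n \<Longrightarrow> distr M P (Z i) = P"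
  defines "J \<equiv> \<lambda>\<omega>. (\<lambda>i\<in>{..<n}. Z i \<omega>, Z n \<omega>)"
  shows "J \<in> measurable M (PiM {..<n} (\<lambda>_. P) \<Otimes>\<^sub>M P)"
    and "distr M (PiM {..<n} (\<lambda>_. P) \<Otimes>\<^sub>M P) J = PiM {..<n} (\<lambda>_. P) \<Otimes>\<^sub>M P"
proof -
  interpret M: prob_space M by fact
  let ?N = "PiM {..n} (\<lambda>_. P)" and ?U = "\<lambda>\<omega>. \<lambda>i\<in>{..n}. Z i \<omega>"
  have rv: "Z i \<in> measurable M P" if "i \<in> {..n}" for i
    using iid(1) that unfolding M.indep_vars_def2 by blast
  have U: "?U \<in> measurable M ?N"
    using rv by (intro measurable_restrict)
  have "distr M ?N ?U = PiM {..n} (\<lambda>i. distr M P (Z i))"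
    using M.indep_vars_iff_distr_eq_PiM'[where I = "{..n}" and M' = "\<lambda>_. P" and X = Z] rv iid(1) by auto
  also have "\<dots> = ?N"
    using iid(2) by (intro PiM_cong) auto
  finally have dU: "distr M ?N ?U = ?N" .
  have J: "J = (\<lambda>t. (restrict t {..<n}, t n)) \<circ> ?U"
    by (auto simp: J_def fun_eq_iff)
  show "J \<in> measurable M (PiM {..<n} (\<lambda>_. P) \<Otimes>\<^sub>M P)"
    unfolding J by (rule measurable_comp[OF U measurable_split_last])
  show "distr M (PiM {..<n} (\<lambda>_. P) \<Otimes>\<^sub>M P) J = PiM {..<n} (\<lambda>_. P) \<Otimes>\<^sub>M P"
    using distr_distr[OF measurable_split_last U] distr_split_last[OF P, of n]
    unfolding J dU by simp
qed

text \<open>The objective sees the test point only through its input. Its quasi-integrability is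
  given for the law of sample and input, which is the image of the law of sample and test point
  under forgetting the label.\<close>

lemma quasi_integrable_sample_bound:
  assumes P: "prob_space P" "sets P = sets (MX \<Otimes>\<^sub>M MY)"
    and B: "bound_well_defined n P MX MY l \<phi> fhat g"
  shows "quasi_integrable (sample_space n P \<Otimes>\<^sub>M P)
    (\<lambda>v. minmax_obj n MY l \<phi> fhat (fst v) (fst (snd v)) (g (fst v) (fst (snd v))))"
proof -
  interpret P: prob_space P by fact
  have fst_m[measurable]: "fst \<in> measurable P MX"
    using measurable_cong_sets[OF P(2) refl] measurable_fst by blast
  interpret D: prob_space "distr P MX fst"
    by (rule P.prob_space_distr[OF fst_m])
  have "distr (sample_space n P) (sample_space n P) (\<lambda>s. s) \<Otimes>\<^sub>M distr P MX fst
      = distr (sample_space n P \<Otimes>\<^sub>M P) (sample_space n P \<Otimes>\<^sub>M MX) (\<lambda>(s, z). (s, fst z))"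
    by (rule pair_measure_distr) (auto intro: D.sigma_finite_measure_axioms)
  then have "quasi_integrable (distr (sample_space n P \<Otimes>\<^sub>M P) (sample_space n P \<Otimes>\<^sub>M MX) (\<lambda>(s, z). (s, fst z)))
      (\<lambda>(s, x). minmax_obj n MY l \<phi> fhat s x (g s x))"
    using B by (simp add: bound_well_defined_def distr_id)
  from quasi_integrable_distr[OF _ this] show ?thesis
    by (simp add: case_prod_unfold)
qed

section \<open>Excess risk bound and optimality of the minmax predictor\<close>

theorem theorem1:
  fixes MX :: "'x measure" and MY :: "'y measure" and MW :: "'w measure"
    and P :: "('x \<times> 'y) measure"
    and l :: "'w \<Rightarrow> 'y \<Rightarrow> real"
    and F :: "('x \<Rightarrow> 'w) set" and \<phi> :: "('x \<Rightarrow> 'w) \<Rightarrow> real"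
    and n :: nat
    and fhat :: "(nat \<Rightarrow> 'x \<times> 'y) \<Rightarrow> 'x \<Rightarrow> 'w"
    and M :: "'a measure" and Z :: "nat \<Rightarrow> 'a \<Rightarrow> 'x \<times> 'y"
    and S :: "'a \<Rightarrow> nat \<Rightarrow> 'x \<times> 'y" and X :: "'a \<Rightarrow> 'x"
  defines "S \<equiv> \<lambda>\<omega>. \<lambda>i\<in>{..<n}. Z i \<omega>"
    and "X \<equiv> \<lambda>\<omega>. fst (Z n \<omega>)"
  assumes P: "prob_space P" "sets P = sets (MX \<Otimes>\<^sub>M MY)"
    and loss: "(\<lambda>(w, y). l w y) \<in> borel_measurable (MW \<Otimes>\<^sub>M MY)"
    and F: "F \<subseteq> measurable MX MW"
    and risks: "\<And>f. f \<in> F \<Longrightarrow> risk_well_defined P l f"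
    and inf_finite: "\<bar>INF f\<in>F. pen_risk P l \<phi> f\<bar> \<noteq> \<infinity>"
    and fhat: "pen_erm n P l \<phi> F fhat" "symmetric_on_samples n P fhat"
    and M: "prob_space M"
    and iid: "prob_space.indep_vars M (\<lambda>_. P) Z {..n}" "\<And>i. i \<le> n \<Longrightarrow> distr M P (Z i) = P"
  shows "(\<forall>g. sample_predictor n P MX MW g \<and> expected_risk_well_defined n P l g \<and>
              bound_well_defined n P MX MY l \<phi> fhat g \<longrightarrow>
            expect M (\<lambda>\<omega>. pen_excess_risk P l \<phi> F (g (S \<omega>)))
              \<le> expect M (\<lambda>\<omega>. minmax_obj n MY l \<phi> fhat (S \<omega>) (X \<omega>) (g (S \<omega>) (X \<omega>)))) \<and>
         (\<forall>ft. sample_minmax_predictor n P MX MY MW l \<phi> fhat ft \<and>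
               bound_well_defined n P MX MY l \<phi> fhat ft \<longrightarrow>
            (\<forall>g. sample_predictor n P MX MW g \<and> bound_well_defined n P MX MY l \<phi> fhat g \<longrightarrow>
               expect M (\<lambda>\<omega>. minmax_obj n MY l \<phi> fhat (S \<omega>) (X \<omega>) (ft (S \<omega>) (X \<omega>)))
                 \<le> expect M (\<lambda>\<omega>. minmax_obj n MY l \<phi> fhat (S \<omega>) (X \<omega>) (g (S \<omega>) (X \<omega>)))) \<and>
            (expected_risk_well_defined n P l ft \<longrightarrow>
               expect M (\<lambda>\<omega>. pen_excess_risk P l \<phi> F (ft (S \<omega>)))
                 \<le> expect M (\<lambda>\<omega>. INF w\<in>space MW. minmax_obj n MY l \<phi> fhat (S \<omega>) (X \<omega>) w)))"
proof -
  let ?R = "sample_space n P"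
  let ?Q = "?R \<Otimes>\<^sub>M P"
  let ?obj = "minmax_obj n MY l \<phi> fhat"
  let ?c = "INF f\<in>F. pen_risk P l \<phi> f"
  define B where "B g v = ?obj (fst v) (fst (snd v)) (g (fst v) (fst (snd v)))"
    for g and v :: "(nat \<Rightarrow> 'x \<times> 'y) \<times> ('x \<times> 'y)"
  interpret P: prob_space P by (rule P)
  interpret R: prob_space ?R by (intro prob_space_PiM P)
  have spP: "space P = space MX \<times> space MY"
    using sets_eq_imp_space_eq[OF P(2)] by (simp add: space_pair_measure)
  define J where "J \<omega> = (S \<omega>, Z n \<omega>)" for \<omega>
  have J: "J \<in> measurable M ?Q" "distr M ?Q J = ?Q"
    using iid_split_last[OF M P(1) iid] by (simp_all add: J_def[abs_def] S_def)
  have S_m: "S \<in> measurable M ?R"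
    using measurable_compose[OF J(1) measurable_fst] by (simp add: J_def)
  have S_d: "distr M ?R S = ?R"
  proof -
    have "distr M ?R S = distr (distr M ?Q J) ?R fst"
      using J(1) by (subst distr_distr) (simp_all add: comp_def J_def)
    then show ?thesis
      by (simp add: J(2) P.distr_pair_fst)
  qed
  have S_sp: "S \<omega> \<in> space ?R" and X_sp: "X \<omega> \<in> space MX" if "\<omega> \<in> space M" for \<omega>
    using measurable_space[OF J(1) that]
    by (auto simp: J_def X_def spP space_pair_measure mem_Times_iff)

  have bound: "expect M (\<lambda>\<omega>. pen_excess_risk P l \<phi> F (g (S \<omega>)))
      \<le> expect M (\<lambda>\<omega>. ?obj (S \<omega>) (X \<omega>) (g (S \<omega>) (X \<omega>)))"
    if risk: "expected_risk_well_defined n P l g"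
      and bwd: "bound_well_defined n P MX MY l \<phi> fhat g" for g
  proof -
    let ?L = "\<lambda>v. ereal (pred_loss l (g (fst v)) (snd v))"
    have qL: "quasi_integrable ?Q ?L"
      using risk by (simp add: expected_risk_well_defined_def case_prod_unfold)
    have qB: "quasi_integrable ?Q (B g)"
      using quasi_integrable_sample_bound[OF P bwd] by (simp add: B_def[abs_def])
    have inner: "expect P (\<lambda>z. ?L (s, z)) \<noteq> - \<infinity>" "quasi_integrable P (\<lambda>z. ?L (s, z))"
      if "s \<in> space ?R" for s
      using risk that
      by (auto simp: expected_risk_well_defined_def risk_well_defined_def risk_def)
    have exc: "pen_excess_risk P l \<phi> F (g s) = expect P (\<lambda>z. ?L (s, z)) - ?c" for s
      by (simp add: pen_excess_risk_def risk_def)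
    note iter = expect_iterated_diff_const[OF R.prob_space_axioms P(1) qL inf_finite inner]
    \<comment> \<open>The excess risk depends on the sample alone and is moved to the law of
      \<open>S\<close>; the bound in \<open>rhs\<close> involves the test input too and is moved to
      the law of \<open>J\<close>.\<close>
    have "expect M (\<lambda>\<omega>. pen_excess_risk P l \<phi> F (g (S \<omega>)))
        = expect ?R (\<lambda>s. pen_excess_risk P l \<phi> F (g s))"
      using expect_distr[OF S_m iter(2)] by (simp add: exc S_d)
    also have "\<dots> = expect ?Q ?L - ?c"
      unfolding exc using iter(1) by simp
    finally have lhs: "expect M (\<lambda>\<omega>. pen_excess_risk P l \<phi> F (g (S \<omega>))) = expect ?Q ?L - ?c" .
    have rhs: "expect M (\<lambda>\<omega>. ?obj (S \<omega>) (X \<omega>) (g (S \<omega>) (X \<omega>))) = expect ?Q (B g)"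
      using expect_distr[OF J(1), of "B g"] qB
      by (simp add: J(2) quasi_integrable_def B_def J_def X_def)
    \<comment> \<open>Competitors of infinite penalized risk do not affect the finite infimum, and
      that infimum keeps the remaining risks above minus infinity.\<close>
    have le: "expect ?Q ?L \<le> expect ?Q (B g) + pen_risk P l \<phi> f"
      if f: "f \<in> F" "pen_risk P l \<phi> f \<noteq> \<infinity>" for f
    proof -
      have "?c \<le> pen_risk P l \<phi> f"
        using f(1) by (rule INF_lower)
      then have fin: "\<bar>pen_risk P l \<phi> f\<bar> \<noteq> \<infinity>"
        using inf_finite f(2) by (cases "pen_risk P l \<phi> f"; cases ?c) auto
      have "(\<lambda>z. ereal (pred_loss l f z)) \<in> borel_measurable P"
        using risks[OF f(1)] by (simp add: risk_well_defined_def quasi_integrable_def)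
      from borel_measurable_real_of_ereal[OF this]
      have "(\<lambda>z. pen_loss l \<phi> f z) \<in> borel_measurable P"
        by (simp add: pen_loss_def pred_loss_def)
      with expected_risk_le[OF P fhat qL _ f(1) _ fin] qB show ?thesis
        by (simp add: B_def[abs_def])
    qed
    have "expect ?Q ?L \<le> expect ?Q (B g) + ?c"
    proof (cases "expect ?Q (B g)")
      case (real b)
      have "expect ?Q ?L - expect ?Q (B g) \<le> ?c"
      proof (rule INF_greatest)
        fix f assume "f \<in> F"
        then show "expect ?Q ?L - expect ?Q (B g) \<le> pen_risk P l \<phi> f"
          using le[of f] real by (cases "pen_risk P l \<phi> f = \<infinity>") (auto simp: ereal_minus_le add.commute)
      qed
      then show ?thesis
        using real by (simp add: ereal_minus_le add.commute)
    next
      \<comment> \<open>Nothing can be subtracted here. As the infimum is finite, some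
        \<open>f\<close> has penalized risk below infinity, and comparison with it forces the
        expected loss to be minus infinity as well.\<close>
      case MInf
      have "?c < \<infinity>"
        using inf_finite by auto
      then obtain f where "f \<in> F" "pen_risk P l \<phi> f < \<infinity>"
        unfolding INF_less_iff by blast
      with le[of f] MInf show ?thesis
        by (cases "pen_risk P l \<phi> f") auto
    qed simp
    then show ?thesis
      unfolding lhs rhs using inf_finite by (cases ?c) (auto simp: ereal_minus_le)
  qed

  \<comment> \<open>\<open>is_arg_min\<close> denies a strictly smaller value; in the linear order
    of \<open>ereal\<close> this is minimality.\<close>
  have minimal: "?obj s x (ft s x) \<le> ?obj s x w"
    if "sample_minmax_predictor n P MX MY MW l \<phi> fhat ft"
      and "s \<in> space ?R" "x \<in> space MX" "w \<in> space MW" for ft s x w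
    using that unfolding sample_minmax_predictor_def is_arg_min_def by (force simp: not_less)
  have pred_sp: "g s x \<in> space MW"
    if "sample_predictor n P MX MW g" "s \<in> space ?R" "x \<in> space MX" for g s x
    using that measurable_space[of "\<lambda>(s, x). g s x" "?R \<Otimes>\<^sub>M MX" MW "(s, x)"]
    by (simp add: sample_predictor_def space_pair_measure)
  \<comment> \<open>The minmax predictor minimizes pointwise, so its own bound already is the
    expected infimum of the last claim.\<close>
  have attained: "(INF w\<in>space MW. ?obj (S \<omega>) (X \<omega>) w) = ?obj (S \<omega>) (X \<omega>) (ft (S \<omega>) (X \<omega>))"
    if ft: "sample_minmax_predictor n P MX MY MW l \<phi> fhat ft" and "\<omega> \<in> space M" for ft \<omega>
  proof (intro antisym INF_lower INF_greatest)
    show "ft (S \<omega>) (X \<omega>) \<in> space MW"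
      using ft S_sp[OF that(2)] X_sp[OF that(2)]
      by (intro pred_sp) (simp_all add: sample_minmax_predictor_def)
  qed (rule minimal[OF ft S_sp[OF that(2)] X_sp[OF that(2)]])
  show ?thesis
  proof (intro conjI allI impI; elim conjE)
    fix g
    assume "expected_risk_well_defined n P l g" "bound_well_defined n P MX MY l \<phi> fhat g"
    then show "expect M (\<lambda>\<omega>. pen_excess_risk P l \<phi> F (g (S \<omega>)))
        \<le> expect M (\<lambda>\<omega>. ?obj (S \<omega>) (X \<omega>) (g (S \<omega>) (X \<omega>)))"
      by (rule bound)
  next
    fix ft g
    assume "sample_minmax_predictor n P MX MY MW l \<phi> fhat ft" "sample_predictor n P MX MW g"
    then show "expect M (\<lambda>\<omega>. ?obj (S \<omega>) (X \<omega>) (ft (S \<omega>) (X \<omega>)))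
        \<le> expect M (\<lambda>\<omega>. ?obj (S \<omega>) (X \<omega>) (g (S \<omega>) (X \<omega>)))"
      by (intro expect_mono minimal pred_sp S_sp X_sp)
  next
    fix ft
    assume ft: "sample_minmax_predictor n P MX MY MW l \<phi> fhat ft"
      and wd: "expected_risk_well_defined n P l ft" "bound_well_defined n P MX MY l \<phi> fhat ft"
    show "expect M (\<lambda>\<omega>. pen_excess_risk P l \<phi> F (ft (S \<omega>)))
        \<le> expect M (\<lambda>\<omega>. INF w\<in>space MW. ?obj (S \<omega>) (X \<omega>) w)"
      using bound[OF wd] by (simp only: attained[OF ft] cong: expect_cong)
  qed
qed

end
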